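(* Let $k \geq 2$ be an integer and let $d$ be the smallest prime divisor of $k$. Let $n$ be an integer with $n \geq k^2-1$ such that $k$ does not divide $n-1$, and consider the numerical semigroup $$S_{k,n} = \langle k, n, n+1, \dots, n+k-1 \rangle.$$ Then every irreducible decomposition of $S_{k,n}$ has at least $d-1$ irreducible components; that is, whenever $S_{k,n} = I_1 \cap \cdots \cap I_m$ with each $I_j$ an irreducible numerical semigroup, one has $m \geq d-1$.
   Context: $\mathbb{N}$ denotes the set of nonnegative integers. A numerical semigroup is a subset $S \subseteq \mathbb{N}$ that contains $0$, is closed under addition, and has finite complement $\mathbb{N}\setminus S$. For a nonempty subset $A \subseteq \mathbb{N}$, $\langle A \rangle$ denotes the set of all finite sums $c_1x_1+\cdots+c_rx_r$ with $c_i \in \mathbb{N}$ and $x_i \in A$ (including $0$); it is a numerical semigroup if and only if $\gcd(A)=1$. A numerical semigroup $\Gamma$ is irreducible if it cannot be written as the intersection of two numerical semigroups each properly containing $\Gamma$. An irreducible decomposition of a numerical semigroup $S$ is an expression of $S$ as the intersection of finitely many irreducible numerical semigroups, which are called the irreducible components of the decomposition. Every numerical semigroup has an irreducible decomposition. *)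

theory Defs
  imports "HOL-Computational_Algebra.Primes"
begin

definition numerical_semigroup :: "nat set \<Rightarrow> bool" where
  "numerical_semigroup S \<longleftrightarrow>
     0 \<in> S \<and> (\<forall>a\<in>S. \<forall>b\<in>S. a + b \<in> S) \<and> finite (UNIV - S)"

definition generated :: "nat set \<Rightarrow> nat set" where
  "generated A = {\<Sum>i<r. c i * x i | (r::nat) (c :: nat \<Rightarrow> nat) x. \<forall>i<r. x i \<in> A}"

definition irreducible_semigroup :: "nat set \<Rightarrow> bool" where
  "irreducible_semigroup T \<longleftrightarrow>
     numerical_semigroup T \<and>
     \<not> (\<exists>U V. numerical_semigroup U \<and> numerical_semigroup V \<and>
           T \<subset> U \<and> T \<subset> V \<and> T = U \<inter> V)"

definition S_sg :: "nat \<Rightarrow> nat \<Rightarrow> nat set" where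
  "S_sg k n = generated ({k} \<union> {n..n + k - 1})"

text \<open>The empty intersection (\<open>m = 0\<close>) is the whole of \<open>UNIV\<close>, as usual for subsets of
  the natural numbers.\<close>

definition irreducible_decomposition :: "nat set \<Rightarrow> nat \<Rightarrow> (nat \<Rightarrow> nat set) \<Rightarrow> bool" where
  "irreducible_decomposition S m I \<longleftrightarrow>
     (\<forall>j\<in>{1..m}. irreducible_semigroup (I j)) \<and> S = (\<Inter>j\<in>{1..m}. I j)"

end

theory Submission
  imports Defs "HOL-Number_Theory.Cong"
begin

text \<open>
  The semigroup \<open>S_sg k n\<close> consists of the multiples of \<open>k\<close> together with all numbers from \<open>n\<close> on.
  Hence among the \<open>d\<close> numbers \<open>n - d, \<dots>, n - 1\<close> at least \<open>d - 1\<close> are gaps of \<open>S_sg k n\<close>, and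
  each of them must be a gap of some component. The point is that one irreducible component \<open>T\<close>
  can account for only one of them.

  Let \<open>F\<close> be the largest gap of \<open>T\<close>. Irreducibility makes the upper half of the gaps symmetric: if
  \<open>x\<close> is a gap with \<open>2 * x > F\<close>, then \<open>F - x \<in> T\<close> (\<open>irreducible_gap_reflection\<close>). If two of
  the chosen gaps \<open>x' < x\<close> were missing from \<open>T\<close>, then \<open>T\<close> would contain \<open>k\<close> and the two numbers
  \<open>F - x < F - x'\<close>, both below \<open>k\<close>. Their difference lies strictly between \<open>0\<close> and \<open>d\<close>, so it is
  coprime to \<open>k\<close> because \<open>d\<close> is the least prime divisor of \<open>k\<close>. But then these three elements alone
  generate every number from \<open>(k - 1)\<^sup>2\<close> on (\<open>contains_all_large_if_coprime_difference\<close>). As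
  \<open>F \<ge> n - k \<ge> (k - 1)\<^sup>2\<close>, the gap \<open>F\<close> would belong to \<open>T\<close>. The pigeonhole principle now
  yields the bound.
\<close>

section \<open>Numerical semigroups\<close>

lemma numerical_semigroup_add:
  "numerical_semigroup T \<Longrightarrow> a \<in> T \<Longrightarrow> b \<in> T \<Longrightarrow> a + b \<in> T"
  by (simp add: numerical_semigroup_def)

lemma numerical_semigroup_mult:
  assumes "numerical_semigroup T" "a \<in> T"
  shows "c * a \<in> T"
  using assms by (induction c) (auto simp: numerical_semigroup_def)

lemma numerical_semigroup_insert:
  assumes "numerical_semigroup T"
    and "\<And>t. t \<in> T \<Longrightarrow> t > 0 \<Longrightarrow> t + h \<in> T"
    and "h + h \<in> T"
  shows "numerical_semigroup (insert h T)"
proof -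
  have "t + h \<in> insert h T" if "t \<in> T" for t
    using assms(2)[OF that] by (cases "t = 0") auto
  moreover have "finite (UNIV - insert h T)"
    using assms(1) by (auto simp: numerical_semigroup_def intro: finite_subset[of _ "UNIV - T"])
  ultimately show ?thesis
    using assms(1,3) unfolding numerical_semigroup_def
    by (auto simp: add.commute)
qed

text \<open>If the reflection \<open>F - x\<close> of a gap in the upper half is again a gap, then the largest gap \<open>h\<close>
  with this property can be added to \<open>T\<close>, and so can \<open>F\<close>; the two enlarged semigroups meet
  in \<open>T\<close>, so \<open>T\<close> is reducible.\<close>

lemma irreducible_gap_reflection:
  assumes irr: "irreducible_semigroup T"
    and F: "F \<notin> T" "\<And>z. z > F \<Longrightarrow> z \<in> T"
    and x: "x \<notin> T" "2 * x > F"
  shows "F - x \<in> T"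
proof (rule ccontr)
  assume refl: "F - x \<notin> T"
  have T: "numerical_semigroup T" using irr by (simp add: irreducible_semigroup_def)
  have zero: "0 \<in> T" using T by (simp add: numerical_semigroup_def)
  define B where "B = {h. h \<notin> T \<and> F - h \<notin> T \<and> 2 * h > F}"
  have le_F: "h \<le> F" if "h \<notin> T" for h using F(2) that by (meson not_le)
  have "B \<subseteq> {..F}" using le_F by (auto simp: B_def)
  then have finB: "finite B" by (rule finite_subset) simp
  have "x \<in> B" using x refl by (simp add: B_def)
  define h where "h = Max B"
  have "h \<in> B" unfolding h_def using finB \<open>x \<in> B\<close> by (intro Max_in) auto
  then have h: "h \<notin> T" "F - h \<notin> T" "2 * h > F" by (auto simp: B_def)
  have "h \<noteq> F" using h(2) zero by auto
  have "F > 0" using F(1) zero by (metis gr0I)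
  have hT: "numerical_semigroup (insert h T)"
  proof (rule numerical_semigroup_insert[OF T])
    fix t assume t: "t \<in> T" "t > 0"
    show "t + h \<in> T"
    proof (rule ccontr)
      assume n: "t + h \<notin> T"
      have "t + h \<le> F" using le_F[OF n] .
      then have "(F - (t + h)) + t = F - h" by simp
      then have "F - (t + h) \<notin> T"
        using numerical_semigroup_add[OF T _ t(1)] h(2) by metis
      then have "t + h \<in> B" using n h(3) by (simp add: B_def)
      then show False using Max_ge[OF finB, of "t + h"] t(2) by (simp add: h_def)
    qed
  next
    show "h + h \<in> T" using F(2) h(3) by simp
  qed
  have FT: "numerical_semigroup (insert F T)"
    using \<open>F > 0\<close> by (intro numerical_semigroup_insert[OF T]) (auto intro: F(2))
  have "T \<subset> insert h T" "T \<subset> insert F T" "T = insert h T \<inter> insert F T"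
    using h(1) F(1) \<open>h \<noteq> F\<close> by auto
  then show False using irr hT FT unfolding irreducible_semigroup_def by blast
qed

text \<open>The sums of \<open>k - 1\<close> summands from \<open>{y, y'}\<close> are the numbers \<open>(k - 1) * y + a * (y' - y)\<close> with
  \<open>a < k\<close>. They represent every residue class modulo \<open>k\<close>, because \<open>y' - y\<close> is a unit there, and none
  exceeds \<open>(k - 1)\<^sup>2\<close>.\<close>

lemma contains_all_large_if_coprime_difference:
  fixes k y y' z :: nat
  assumes T: "numerical_semigroup T" and mem: "k \<in> T" "y \<in> T" "y' \<in> T"
    and y: "y < y'" "y' < k" and cop: "coprime (y' - y) k"
    and z: "z \<ge> (k - 1)\<^sup>2"
  shows "z \<in> T"
proof -
  define \<delta> where "\<delta> = y' - y"
  define c where "c = (k - 1) * y"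
  have "k > 0" using y by simp
  have "c \<le> (k - 1) * (k - 1)" unfolding c_def using y by (intro mult_le_mono) auto
  then have cz: "c \<le> z" using z by (simp add: power2_eq_square)
  obtain u where u: "[\<delta> * u = 1] (mod k)"
    using cong_solve_coprime_nat[of \<delta> k] cop by (auto simp: \<delta>_def)
  define a where "a = (u * (z - c)) mod k"
  have "a < k" using \<open>k > 0\<close> by (simp add: a_def)
  have "[c + \<delta> * a = c + \<delta> * (u * (z - c))] (mod k)"
    by (intro cong_add cong_mult cong_refl) (simp add: a_def cong_def)
  also have "[c + \<delta> * (u * (z - c)) = c + 1 * (z - c)] (mod k)"
    unfolding mult.assoc[symmetric] by (intro cong_add cong_mult cong_refl u)
  finally have cong: "[c + \<delta> * a = z] (mod k)" using cz by simp
  define w where "w = a * y' + (k - 1 - a) * y"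
  have "k - 1 = a + (k - 1 - a)" using \<open>a < k\<close> by simp
  then have "c = a * y + (k - 1 - a) * y" unfolding c_def by (metis add_mult_distrib)
  moreover have "a * y' = a * y + \<delta> * a"
    using y(1) by (simp add: \<delta>_def diff_mult_distrib mult.commute[of a])
  ultimately have w: "w = c + \<delta> * a" by (simp add: w_def)
  have "w \<le> a * (k - 1) + (k - 1 - a) * (k - 1)"
    unfolding w_def using y by (intro add_mono mult_le_mono) auto
  also have "\<dots> = (k - 1)\<^sup>2"
    using \<open>a < k\<close> by (simp add: power2_eq_square flip: add_mult_distrib)
  finally have "w \<le> z" using z by simp
  then have "k dvd z - w" using cong unfolding w[symmetric]
    by (metis cong_altdef_nat cong_sym)
  then obtain q where "z = w + q * k" using \<open>w \<le> z\<close>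
    by (metis dvd_def le_add_diff_inverse mult.commute)
  then show ?thesis unfolding w_def
    using T mem by (simp add: numerical_semigroup_add numerical_semigroup_mult)
qed

section \<open>The semigroup generated by k and the interval from n to n + k - 1\<close>

lemma S_sg_k: "k \<in> S_sg k n"
  unfolding S_sg_def generated_def
  by (rule CollectI, rule exI[of _ 1], rule exI[of _ "\<lambda>_. 1"], rule exI[of _ "\<lambda>_. k"]) simp

lemma S_sg_above:
  assumes "k > 0" "z \<ge> n"
  shows "z \<in> S_sg k n"
proof -
  define c :: "nat \<Rightarrow> nat" where "c i = (if i = 0 then 1 else (z - n) div k)" for i
  define x where "x i = (if i = 0 then n + (z - n) mod k else k)" for i :: nat
  have "z = (\<Sum>i<2. c i * x i)"
    using assms by (simp add: c_def x_def numeral_2_eq_2)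
  moreover have "(z - n) mod k < k" using assms by simp
  then have "\<forall>i<2. x i \<in> {k} \<union> {n..n + k - 1}" by (auto simp: x_def)
  ultimately show ?thesis unfolding S_sg_def generated_def by blast
qed

lemma S_sg_below:
  assumes "z \<in> S_sg k n" "z < n"
  shows "k dvd z"
proof -
  obtain r :: nat and c x :: "nat \<Rightarrow> nat" where z: "z = (\<Sum>i<r. c i * x i)"
    and x: "\<And>i. i < r \<Longrightarrow> x i \<in> {k} \<union> {n..n + k - 1}"
    using assms(1) unfolding S_sg_def generated_def by blast
  have "k dvd c i * x i" if "i < r" for i
  proof (cases "c i = 0 \<or> x i = k")
    case False
    then have "n \<le> x i" "1 \<le> c i" using x[OF that] by auto
    then have "n \<le> c i * x i" using mult_le_mono[of 1 "c i" n "x i"] by simp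
    also have "c i * x i \<le> z" unfolding z using that by (intro member_le_sum) auto
    finally show ?thesis using assms(2) by simp
  qed auto
  then show ?thesis unfolding z by (intro dvd_sum) auto
qed

section \<open>The lower bound\<close>

text \<open>If two numbers from \<open>n - k, \<dots>, n - 1\<close> are missing from \<open>T\<close> and \<open>F\<close> is the largest gap of \<open>T\<close>,
  then both lie in the upper half of \<open>{0..F}\<close>, so their reflections are in \<open>T\<close>. At a distance
  coprime to \<open>k\<close> these reflections would, together with \<open>k\<close>, generate \<open>F\<close> itself.\<close>

lemma irreducible_misses_no_coprime_pair:
  assumes k: "k \<ge> 2" and n: "n \<ge> k\<^sup>2 - 1" "\<not> k dvd n - 1"
    and T: "irreducible_semigroup T" "S_sg k n \<subseteq> T"
    and x: "x' < x" "n \<le> x' + k" "x \<notin> T" "x' \<notin> T"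
  shows "\<not> coprime (x - x') k"
proof
  assume cop: "coprime (x - x') k"
  have nT: "numerical_semigroup T" using T(1) by (simp add: irreducible_semigroup_def)
  have finT: "finite (UNIV - T)" using nT by (simp add: numerical_semigroup_def)
  have above: "z \<in> T" if "z \<ge> n" for z
    using S_sg_above[of k n z] k that T(2) by auto
  define F where "F = Max (UNIV - T)"
  have FT: "F \<notin> T" using Max_in[OF finT] x(3) by (auto simp: F_def)
  have F_max: "z \<in> T" if "z > F" for z
    using Max_ge[OF finT, of z] that by (auto simp: F_def)
  have "F < n" using above FT by (meson not_le)
  have xF: "x \<le> F" using F_max x(3) by (meson not_le)
  have sq: "(k - 1)\<^sup>2 + k \<le> k\<^sup>2 - 1"
  proof -
    obtain j where "k = j + 2" using k by (metis le_Suc_ex add.commute)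
    then show ?thesis by (simp add: power2_eq_square)
  qed
  \<comment> \<open>For \<open>k = 2\<close> the bound \<open>n \<ge> 3\<close> falls short of \<open>2 * k\<close>; there \<open>n\<close> is even.\<close>
  have "2 * k \<le> n"
  proof (cases "k = 2")
    case True
    then have "odd (n - 1)" "n \<ge> 3" using n by auto
    then have "n \<noteq> 3" by auto
    with \<open>n \<ge> 3\<close> True show ?thesis by simp
  next
    case False
    then have "3 * k \<le> k\<^sup>2" using k by (simp add: power2_eq_square)
    then show ?thesis using n(1) k by linarith
  qed
  have R: "F - x \<in> T" "F - x' \<in> T"
    using irreducible_gap_reflection[OF T(1) FT F_max] x \<open>2 * k \<le> n\<close> \<open>F < n\<close> by auto
  have "F \<in> T"
  proof (rule contains_all_large_if_coprime_difference[OF nT _ R])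
    show "k \<in> T" using S_sg_k T(2) by blast
    show "F - x < F - x'" using x(1) xF by simp
    show "F - x' < k" using x(2) k \<open>F < n\<close> by arith
    show "coprime (F - x' - (F - x)) k" using cop x(1) xF by simp
    show "(k - 1)\<^sup>2 \<le> F" using sq n(1) x(1,2) xF by linarith
  qed
  then show False using FT by simp
qed

lemma coprime_below_least_prime_divisor:
  fixes \<delta> k :: nat
  assumes "0 < \<delta>" "\<delta> < (LEAST p. prime p \<and> p dvd k)"
  shows "coprime \<delta> k"
proof (rule ccontr)
  assume "\<not> coprime \<delta> k"
  then have "gcd \<delta> k \<noteq> 1" by (simp add: coprime_iff_gcd_eq_1)
  then obtain p where p: "prime p" "p dvd gcd \<delta> k" using prime_factor_nat by blast
  then have "(LEAST p. prime p \<and> p dvd k) \<le> p" by (intro Least_le) auto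
  moreover have "p \<le> \<delta>" using p assms(1) by (intro dvd_imp_le) auto
  ultimately show False using assms(2) by simp
qed

lemma card_nonmultiples_in_window:
  fixes d k n :: nat
  assumes "d \<le> k" "d \<le> n"
  shows "d - 1 \<le> card {x \<in> {n - d..<n}. \<not> k dvd x}"
proof -
  have "x = y" if "x \<in> {n - d..<n}" "k dvd x" "y \<in> {n - d..<n}" "k dvd y" for x y
  proof -
    have "k dvd x - y" "k dvd y - x" using that by (auto intro: dvd_diff_nat)
    moreover have "x - y < k" "y - x < k" using that assms by auto
    ultimately have "x - y = 0" "y - x = 0" by (meson nat_dvd_not_less gr0I)+
    then show ?thesis by simp
  qed
  then have "card {x \<in> {n - d..<n}. k dvd x} \<le> Suc 0"
    by (subst card_le_Suc0_iff_eq) auto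
  moreover have "{n - d..<n} = {x \<in> {n - d..<n}. k dvd x} \<union> {x \<in> {n - d..<n}. \<not> k dvd x}"
    by blast
  then have "card {n - d..<n} \<le>
      card {x \<in> {n - d..<n}. k dvd x} + card {x \<in> {n - d..<n}. \<not> k dvd x}"
    by (metis card_Un_le)
  ultimately show ?thesis using assms by simp
qed

theorem theorem2p2:
  fixes k n d m :: nat and I :: "nat \<Rightarrow> nat set"
  assumes "k \<ge> 2"
    and "d = (LEAST p. prime p \<and> p dvd k)"
    and "n \<ge> k^2 - 1"
    and "\<not> k dvd (n - 1)"
    and "irreducible_decomposition (S_sg k n) m I"
  shows "m \<ge> d - 1"
proof -
  have irr: "irreducible_semigroup (I j)" if "j \<in> {1..m}" for j
    using assms(5) that by (simp add: irreducible_decomposition_def)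
  have S: "S_sg k n = (\<Inter>j\<in>{1..m}. I j)"
    using assms(5) by (simp add: irreducible_decomposition_def)
  obtain p where p: "prime p" "p dvd k" using assms(1) prime_factor_nat[of k] by auto
  then have "d \<le> p" unfolding assms(2) by (intro Least_le) auto
  also have "p \<le> k" using p assms(1) by (intro dvd_imp_le) auto
  finally have "d \<le> k" .
  have "2 * k \<le> k\<^sup>2" using assms(1) by (simp add: power2_eq_square)
  then have "d \<le> n" using \<open>d \<le> k\<close> assms(1,3) by linarith
  define G where "G = {x \<in> {n - d..<n}. \<not> k dvd x}"
  have "\<forall>x\<in>G. \<exists>j\<in>{1..m}. x \<notin> I j"
  proof
    fix x assume "x \<in> G"
    then have "x \<notin> S_sg k n" using S_sg_below[of x k n] by (auto simp: G_def)
    then show "\<exists>j\<in>{1..m}. x \<notin> I j" by (auto simp: S)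
  qed
  then obtain f where f: "\<And>x. x \<in> G \<Longrightarrow> f x \<in> {1..m}" "\<And>x. x \<in> G \<Longrightarrow> x \<notin> I (f x)"
    by metis
  have no_pair: False if "x' < x" "x \<in> G" "x' \<in> G" "f x = f x'" for x x'
  proof -
    have "S_sg k n \<subseteq> I (f x)" using f(1)[OF that(2)] by (auto simp: S)
    moreover have "n \<le> x' + k" using that(3) \<open>d \<le> k\<close> by (auto simp: G_def)
    moreover have "x' \<notin> I (f x)" using f(2)[OF that(3)] that(4) by simp
    ultimately have "\<not> coprime (x - x') k"
      using irreducible_misses_no_coprime_pair[OF assms(1,3,4) irr] f that(1,2) by blast
    moreover have "coprime (x - x') k"
      using that(1-3) assms(2) by (intro coprime_below_least_prime_divisor) (auto simp: G_def)
    ultimately show False by simp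
  qed
  have "inj_on f G" by (rule linorder_inj_onI') (metis no_pair)
  then have "card G \<le> card {1..m}" using f(1) by (intro card_inj_on_le) auto
  then show ?thesis
    using card_nonmultiples_in_window[OF \<open>d \<le> k\<close> \<open>d \<le> n\<close>] by (simp add: G_def)
qed

end
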